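(* Let $K\in\mathbb{N}$ and let $\pi_1,\ldots,\pi_K$ be probability densities on $\mathbb{R}$ with $0<\int_{\mathbb{R}}\prod_{i=1}^{K}\pi_i(x)\,dx<\infty$. Suppose that under the $K$-component model $M_K$ the vector $\lambda^{(K)}=(\lambda_{1},\ldots,\lambda_{K})'$ of mixture parameters has the prior constrained by the identifiability restriction $\lambda_1\le\lambda_2\le\ldots\le\lambda_K$, i.e. (properly normalized) joint density $$p_\lambda(\lambda_1,\ldots,\lambda_K)\propto\left[\prod_{i=1}^{K}\pi_i(\lambda_i)\right]\mathbb{I}_{C_K}(\lambda_1,\ldots,\lambda_K),\qquad C_K=\{(c_1,\ldots,c_K)'\in\mathbb{R}^K:c_1\le c_2\le\ldots\le c_K\}.$$ Then the prior of $\lambda^{(K)}$ under $M_K$ and the prior, with density $\pi(\cdot|M_1)$, of the corresponding scalar parameter $\lambda_1$ under the single-component model $M_1$ are coherent if and only if $$\pi(\lambda_1|M_1)\propto\prod_{i=1}^{K}\pi_i(\lambda_1),$$ that is, the coherence condition is the same as for the unconstrained prior $\prod_{i=1}^K\pi_i(\lambda_i)$. In particular, if $\pi_1=\ldots=\pi_K$, the condition becomes $\pi(\lambda_1|M_1)\propto[\pi_1(\lambda_1)]^K$.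
   Context: $\mathbb{I}_{C}$ is the indicator function of $C$. $M_1$ is the single-component model nested in $M_K$ under $\lambda_1=\ldots=\lambda_K$, with a single scalar parameter $\lambda_1$ in place of $\lambda^{(K)}$; $\lambda^{(K)}$ is a priori independent of all other parameters of $M_K$. All priors are proper. Let $\tau_i=\lambda_i-\lambda_1$ ($i=2,\ldots,K$), $\tau=(\tau_2,\ldots,\tau_K)'$ (empty if $K=1$), and let $p(x,t)=p_\lambda(x,t_2+x,\ldots,t_K+x)$ be the joint prior density of $(\lambda_1,\tau)$ under $M_K$, with $p_\lambda$ evaluated pointwise. The priors of $\lambda^{(K)}$ under $M_K$ and of $\lambda_1$ under $M_1$ are coherent if $\pi(\cdot|M_1)$ equals the conditional density of $\lambda_1$ given $\tau=0$ under $M_K$, i.e. $\pi(x|M_1)=p(x,0)/\int_{\mathbb{R}}p(u,0)\,du$. Equality and proportionality of densities are understood Lebesgue-almost everywhere. *)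

theory Defs
  imports "HOL-Probability.Probability"
begin

definition prob_density :: "'a measure \<Rightarrow> ('a \<Rightarrow> real) \<Rightarrow> bool" where
  "prob_density M f \<longleftrightarrow>
     f \<in> borel_measurable M \<and> (\<forall>x\<in>space M. 0 \<le> f x) \<and> (\<integral>\<^sup>+x. ennreal (f x) \<partial>M) = 1"

definition proportional :: "(real \<Rightarrow> real) \<Rightarrow> (real \<Rightarrow> real) \<Rightarrow> bool" where
  "proportional f g \<longleftrightarrow> (\<exists>c>0. AE x in lborel. f x = c * g x)"

text \<open>A vector in \<open>\<real>\<^sup>K\<close> is an extensional function on the index set \<open>{1..K}\<close>, and
  Lebesgue measure on \<open>\<real>\<^sup>K\<close> is the product measure.\<close>

definition lborel_vec :: "nat \<Rightarrow> (nat \<Rightarrow> real) measure" where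
  "lborel_vec K = PiM {1..K} (\<lambda>_. lborel)"

definition ordered_cone :: "nat \<Rightarrow> (nat \<Rightarrow> real) set" where
  "ordered_cone K = {c \<in> {1..K} \<rightarrow>\<^sub>E UNIV. \<forall>i\<in>{1..<K}. c i \<le> c (Suc i)}"

text \<open>For \<open>K \<ge> 2\<close> the diagonal, where coherence evaluates the density, is a null set of
  \<open>\<real>\<^sup>K\<close>, so the joint densities are fixed pointwise rather than up to null sets.\<close>

definition unconstrained_prior :: "nat \<Rightarrow> (nat \<Rightarrow> real \<Rightarrow> real) \<Rightarrow> (nat \<Rightarrow> real) \<Rightarrow> real" where
  "unconstrained_prior K \<pi> l = (\<Prod>i=1..K. \<pi> i (l i))"

definition constrained_prior :: "nat \<Rightarrow> (nat \<Rightarrow> real \<Rightarrow> real) \<Rightarrow> (nat \<Rightarrow> real) \<Rightarrow> real" where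
  "constrained_prior K \<pi> l =
     (\<Prod>i=1..K. \<pi> i (l i)) * indicator (ordered_cone K) l /
     (\<integral>m. (\<Prod>i=1..K. \<pi> i (m i)) * indicator (ordered_cone K) m \<partial>lborel_vec K)"

text \<open>The joint density of \<open>(\<lambda>\<^sub>1, \<tau>)\<close> with \<open>\<tau>\<^sub>i = \<lambda>\<^sub>i - \<lambda>\<^sub>1\<close>, where \<open>\<tau>\<close> has index set
  \<open>{2..K}\<close>; the change of variables has Jacobian 1.\<close>

definition joint_density :: "nat \<Rightarrow> ((nat \<Rightarrow> real) \<Rightarrow> real) \<Rightarrow> real \<Rightarrow> (nat \<Rightarrow> real) \<Rightarrow> real" where
  "joint_density K p_lam x t = p_lam (\<lambda>i\<in>{1..K}. if i = 1 then x else t i + x)"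

text \<open>If the normalizing integral is zero or diverges, the right-hand side below is 0 by the
  conventions for division and the Bochner integral, so no probability density is coherent.\<close>

definition coherent :: "nat \<Rightarrow> ((nat \<Rightarrow> real) \<Rightarrow> real) \<Rightarrow> (real \<Rightarrow> real) \<Rightarrow> bool" where
  "coherent K p_lam q \<longleftrightarrow>
     (let \<tau>\<^sub>0 = (\<lambda>i\<in>{2..K}. 0) in
      AE x in lborel.
        q x = joint_density K p_lam x \<tau>\<^sub>0 / (\<integral>u. joint_density K p_lam u \<tau>\<^sub>0 \<partial>lborel))"

end

theory Submission
  imports Defs
begin

text \<open>On the diagonal \<open>\<tau> = 0\<close> all components are equal, so the point lies in the ordered cone and
  the constrained density is the product \<open>\<Prod>\<^sub>i \<pi>\<^sub>i(x)\<close> divided by the normalizing constant of the cone.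
  Conditioning on \<open>\<tau> = 0\<close> renormalizes in \<open>x\<close>, so this constant cancels, exactly as the constant
  \<open>1\<close> does for the unconstrained prior; this is \<open>coherent_iff_proportional\<close>.

  The cancellation requires the constant to be positive, and this is where
  \<open>0 < \<integral> \<Prod>\<^sub>i \<pi>\<^sub>i(x) dx\<close> enters: all \<open>\<pi>\<^sub>i\<close> are simultaneously positive on a set \<open>A\<close> of positive
  measure. Cutting \<open>A\<close> at suitable thresholds gives \<open>K\<close> pieces of positive measure, each lying to the
  left of the next (\<open>ordered_pieces\<close>). Their product is a set of positive measure inside the cone on
  which the joint density is positive (\<open>cone_integral_pos\<close>).\<close>

section \<open>Cutting a set of positive measure into ordered pieces\<close>

text \<open>If every rational threshold left a null set on one side, discarding these countably many null
  sets would leave a set with no two distinct points, hence a null set.\<close>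

lemma split_positive_measure:
  fixes A :: "real set"
  assumes A: "A \<in> sets lborel" and pos: "emeasure lborel A > 0"
  shows "\<exists>t. emeasure lborel (A \<inter> {..t}) > 0 \<and> emeasure lborel (A \<inter> {t<..}) > 0"
proof (rule ccontr)
  assume neg: "\<not> ?thesis"
  have [measurable]: "A \<in> sets borel" using A by simp
  define S where "S t = (if emeasure lborel (A \<inter> {..t}) = 0 then A \<inter> {..t} else A \<inter> {t<..})" for t
  have S_null: "S t \<in> null_sets lborel" for t
    using neg unfolding S_def by (auto simp: null_sets_def zero_less_iff_neq_zero)
  define N where "N = (\<Union>r\<in>\<rat>. S r)"
  have N_null: "N \<in> null_sets lborel"
    unfolding N_def by (intro null_sets_UN') (auto simp: countable_rat S_null)
  have single: False if "x \<in> A - N" "y \<in> A - N" "x < y" for x y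
  proof -
    obtain r where r: "r \<in> \<rat>" "x < r" "r < y" using Rats_dense_in_real[OF \<open>x < y\<close>] by blast
    have "x \<in> S r \<or> y \<in> S r" using that r by (auto simp: S_def)
    then show False using that r by (auto simp: N_def)
  qed
  have "finite (A - N)"
  proof (cases "A - N = {}")
    case False
    then obtain x where "x \<in> A - N" by blast
    then have "A - N \<subseteq> {x}" using single by (metis linorder_neqE subsetI singletonI)
    then show ?thesis using finite_subset by blast
  next
    case True
    show ?thesis unfolding True by simp
  qed
  then have "A - N \<in> null_sets lborel" by (rule finite_imp_null_set_lborel)
  then have "(A - N) \<union> N \<in> null_sets lborel" using N_null by (rule null_sets.Un)
  then have "A \<in> null_sets lborel" by (rule null_sets_subset) (use A in auto)
  then show False using pos by auto
qed

lemma ordered_pieces: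
  fixes A :: "real set"
  assumes "A \<in> sets lborel" and "emeasure lborel A > 0"
  shows "\<exists>B. (\<forall>i\<in>{1..n}. B i \<subseteq> A \<and> B i \<in> sets lborel \<and> emeasure lborel (B i) > 0)
      \<and> (\<forall>i\<in>{1..<n}. \<forall>x\<in>B i. \<forall>y\<in>B (Suc i). x \<le> y)"
  using assms
proof (induction n arbitrary: A)
  case 0
  then show ?case by simp
next
  case (Suc n)
  obtain t where t: "emeasure lborel (A \<inter> {..t}) > 0" "emeasure lborel (A \<inter> {t<..}) > 0"
    using split_positive_measure[OF Suc.prems] by blast
  have sets: "A \<inter> {..t} \<in> sets lborel" "A \<inter> {t<..} \<in> sets lborel"
    using Suc.prems(1) by auto
  from Suc.IH[OF sets(1) t(1)] obtain B where
    B: "\<forall>i\<in>{1..n}. B i \<subseteq> A \<inter> {..t} \<and> B i \<in> sets lborel \<and> emeasure lborel (B i) > 0"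
      "\<forall>i\<in>{1..<n}. \<forall>x\<in>B i. \<forall>y\<in>B (Suc i). x \<le> y"
    by (elim exE conjE)
  define B' where "B' = B(Suc n := A \<inter> {t<..})"
  have pieces: "B' i \<subseteq> A \<and> B' i \<in> sets lborel \<and> emeasure lborel (B' i) > 0" if "i \<in> {1..Suc n}" for i
    using that bspec[OF B(1), of i] t sets by (cases "i = Suc n") (auto simp: B'_def)
  have ordered: "x \<le> y" if "i \<in> {1..<Suc n}" "x \<in> B' i" "y \<in> B' (Suc i)" for i x y
  proof (cases "i = n")
    case True
    then have "x \<le> t" "t < y" using that bspec[OF B(1), of n] by (auto simp: B'_def)
    then show ?thesis by simp
  next
    case False
    then show ?thesis using that bspec[OF B(2), of i] by (auto simp: B'_def)
  qed
  show ?case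
    by (rule exI[of _ B'], intro conjI[OF ballI ballI] ballI pieces ordered)
qed

section \<open>The normalizing constant of the constrained prior\<close>

lemma sets_ordered_cone: "ordered_cone K \<in> sets (lborel_vec K)"
proof -
  have "ordered_cone K = {c \<in> space (lborel_vec K). \<forall>i\<in>{1..<K}. c i \<le> c (Suc i)}"
    by (simp add: ordered_cone_def lborel_vec_def space_PiM)
  also have "\<dots> \<in> sets (lborel_vec K)"
  proof (rule sets.sets_Collect_finite_All)
    fix i assume "i \<in> {1..<K}"
    then have [measurable]: "(\<lambda>c. c i) \<in> borel_measurable (lborel_vec K)"
        "(\<lambda>c. c (Suc i)) \<in> borel_measurable (lborel_vec K)"
      unfolding lborel_vec_def by (auto intro!: measurable_component_singleton[where M="\<lambda>_. lborel", simplified])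
    show "{c \<in> space (lborel_vec K). c i \<le> c (Suc i)} \<in> sets (lborel_vec K)"
      by measurable
  qed simp
  finally show ?thesis .
qed

text \<open>The Bochner integral of a nonintegrable function is \<open>0\<close>, so positivity has two parts. The
  integral is finite because dropping the indicator leaves a probability density, and it is nonzero
  because the density is positive on a box of ordered pieces.\<close>

lemma cone_integral_pos:
  fixes \<pi> :: "nat \<Rightarrow> real \<Rightarrow> real"
  assumes dens: "\<And>i. i \<in> {1..K} \<Longrightarrow> prob_density lborel (\<pi> i)"
    and pos: "0 < (\<integral>\<^sup>+x. ennreal (\<Prod>i=1..K. \<pi> i x) \<partial>lborel)"
  shows "0 < (\<integral>m. (\<Prod>i=1..K. \<pi> i (m i)) * indicator (ordered_cone K) m \<partial>lborel_vec K)"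
proof -
  interpret product_sigma_finite "\<lambda>_::nat. lborel :: real measure" ..
  have [measurable]: "\<pi> i \<in> borel_measurable borel" if "i \<in> {1..K}" for i
    using dens[OF that] by (simp add: prob_density_def)
  have nonneg: "0 \<le> \<pi> i x" if "i \<in> {1..K}" for i x
    using dens[OF that] by (simp add: prob_density_def)
  have [measurable]: "ordered_cone K \<in> sets (lborel_vec K)" by (rule sets_ordered_cone)
  let ?p = "\<lambda>m. \<Prod>i=1..K. \<pi> i (m i)"
  let ?f = "\<lambda>m. ?p m * indicator (ordered_cone K) m :: real"
  have p_meas [measurable]: "?p \<in> borel_measurable (lborel_vec K)"
    unfolding lborel_vec_def
  proof (rule borel_measurable_prod)
    fix i assume i: "i \<in> {1..K}"
    have "(\<lambda>m. m i) \<in> measurable (PiM {1..K} (\<lambda>_. lborel :: real measure)) borel"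
      using measurable_component_singleton[OF i, of "\<lambda>_. lborel :: real measure"] by simp
    then show "(\<lambda>m. \<pi> i (m i)) \<in> borel_measurable (PiM {1..K} (\<lambda>_. lborel))"
      by (rule measurable_compose) (use i in measurable)
  qed
  have p_nonneg: "0 \<le> ?p m" for m by (intro prod_nonneg) (auto intro: nonneg)
  have "(\<integral>\<^sup>+m. ennreal (?f m) \<partial>lborel_vec K) \<le> (\<integral>\<^sup>+m. (\<Prod>i\<in>{1..K}. ennreal (\<pi> i (m i))) \<partial>lborel_vec K)"
  proof (rule nn_integral_mono)
    fix m
    have "ennreal (?f m) \<le> ennreal (?p m)"
      using p_nonneg[of m] by (intro ennreal_leI) (simp split: split_indicator)
    also have "\<dots> = (\<Prod>i\<in>{1..K}. ennreal (\<pi> i (m i)))"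
      by (rule prod_ennreal[symmetric]) (rule nonneg)
    finally show "ennreal (?f m) \<le> (\<Prod>i\<in>{1..K}. ennreal (\<pi> i (m i)))" .
  qed
  also have "\<dots> = (\<Prod>i\<in>{1..K}. \<integral>\<^sup>+x. ennreal (\<pi> i x) \<partial>lborel)"
    unfolding lborel_vec_def by (rule product_nn_integral_prod) auto
  also have "\<dots> = 1" using dens by (intro prod.neutral) (auto simp: prob_density_def)
  finally have le1: "(\<integral>\<^sup>+m. ennreal (?f m) \<partial>lborel_vec K) \<le> 1" .
  have f_nonneg: "AE m in lborel_vec K. 0 \<le> ?f m"
    by (intro AE_I2 mult_nonneg_nonneg p_nonneg) simp
  have int: "integrable (lborel_vec K) ?f"
  proof (rule integrableI_nonneg)
    show "?f \<in> borel_measurable (lborel_vec K)" by (intro borel_measurable_times p_meas) measurable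
    show "AE m in lborel_vec K. 0 \<le> ?f m" by (rule f_nonneg)
    show "(\<integral>\<^sup>+m. ennreal (?f m) \<partial>lborel_vec K) < \<infinity>" using le1 by (simp add: le_less_trans)
  qed
  define A where "A = {x. 0 < (\<Prod>i=1..K. \<pi> i x)}"
  have [measurable]: "A \<in> sets borel" unfolding A_def by measurable
  have A_pos: "emeasure lborel A > 0"
  proof (rule ccontr)
    assume "\<not> ?thesis"
    then have "A \<in> null_sets lborel" by (auto simp: null_sets_def zero_less_iff_neq_zero)
    then have "AE x in lborel. x \<notin> A" by (rule AE_not_in)
    then have "AE x in lborel. ennreal (\<Prod>i=1..K. \<pi> i x) = 0"
      by eventually_elim (auto simp: A_def not_less ennreal_neg)
    then have "(\<integral>\<^sup>+x. ennreal (\<Prod>i=1..K. \<pi> i x) \<partial>lborel) = (\<integral>\<^sup>+(x::real). 0 \<partial>lborel)"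
      by (rule nn_integral_cong_AE)
    then show False using pos by simp
  qed
  have "A \<in> sets lborel" by simp
  from ordered_pieces[OF this A_pos, of K] obtain B where
    B: "\<forall>i\<in>{1..K}. B i \<subseteq> A \<and> B i \<in> sets lborel \<and> emeasure lborel (B i) > 0"
      "\<forall>i\<in>{1..<K}. \<forall>x\<in>B i. \<forall>y\<in>B (Suc i). x \<le> y"
    by (elim exE conjE)
  have factor_pos: "0 < \<pi> i x" if "x \<in> A" "i \<in> {1..K}" for i x
  proof (rule ccontr)
    assume "\<not> ?thesis"
    then have "\<pi> i x = 0" using nonneg[OF that(2), of x] by simp
    then have "(\<Prod>i=1..K. \<pi> i x) = 0" using that(2) by (intro prod_zero) auto
    then show False using that(1) by (simp only: A_def mem_Collect_eq less_irrefl)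
  qed
  have f_pos: "0 < ?f m" if "m \<in> (\<Pi>\<^sub>E i\<in>{1..K}. B i)" for m
  proof -
    have "m i \<le> m (Suc i)" if i: "i \<in> {1..<K}" for i
    proof -
      have "m i \<in> B i" "m (Suc i) \<in> B (Suc i)"
        using i by (auto intro!: PiE_mem[OF \<open>m \<in> _\<close>])
      then show ?thesis using bspec[OF B(2) i] by blast
    qed
    moreover have "m \<in> {1..K} \<rightarrow>\<^sub>E UNIV" using that by (simp add: PiE_iff)
    ultimately have "m \<in> ordered_cone K" unfolding ordered_cone_def by blast
    moreover have "0 < ?p m"
    proof (rule prod_pos)
      fix i assume i: "i \<in> {1..K}"
      have "m i \<in> A" using PiE_mem[OF that i] bspec[OF B(1) i] by blast
      then show "0 < \<pi> i (m i)" using i by (rule factor_pos)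
    qed
    ultimately show ?thesis by simp
  qed
  have "0 < (\<Prod>i\<in>{1..K}. emeasure lborel (B i))"
    using B(1) by (auto simp: zero_less_iff_neq_zero)
  also have "\<dots> = emeasure (lborel_vec K) (\<Pi>\<^sub>E i\<in>{1..K}. B i)"
    unfolding lborel_vec_def using B(1) by (intro emeasure_PiM[symmetric]) auto
  finally have box_pos: "0 < emeasure (lborel_vec K) (\<Pi>\<^sub>E i\<in>{1..K}. B i)" .
  have "\<not> (AE m in lborel_vec K. ?f m = 0)"
  proof
    assume "AE m in lborel_vec K. ?f m = 0"
    then have "AE m in lborel_vec K. m \<notin> (\<Pi>\<^sub>E i\<in>{1..K}. B i)"
    proof eventually_elim
      case (elim m)
      then show ?case using f_pos[of m] by (metis less_irrefl)
    qed
    moreover have "(\<Pi>\<^sub>E i\<in>{1..K}. B i) \<in> sets (lborel_vec K)"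
      unfolding lborel_vec_def using B(1) by (intro sets_PiM_I_finite) auto
    ultimately have "(\<Pi>\<^sub>E i\<in>{1..K}. B i) \<in> null_sets (lborel_vec K)"
      by (simp add: AE_iff_null_sets)
    then show False using box_pos by auto
  qed
  then have "integral\<^sup>L (lborel_vec K) ?f \<noteq> 0"
    unfolding integral_nonneg_eq_0_iff_AE[OF int f_nonneg] .
  moreover have "0 \<le> integral\<^sup>L (lborel_vec K) ?f"
    using f_nonneg by (rule integral_nonneg_AE)
  ultimately show ?thesis by linarith
qed

section \<open>Coherence on the diagonal\<close>

text \<open>The scale \<open>c\<close> cancels between the density and its normalizing integral, so coherence says
  \<open>q = P / \<integral>P\<close>. Conversely \<open>q = d P\<close> forces \<open>d = 1 / \<integral>P\<close>, because \<open>q\<close> integrates to \<open>1\<close>.\<close>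

lemma coherent_iff_proportional:
  assumes diag: "\<And>x. joint_density K p_lam x (\<lambda>i\<in>{2..K}. 0) = c * P x" and c: "0 < c"
    and q: "prob_density lborel q"
    and P: "0 < (\<integral>x. P x \<partial>lborel)"
  shows "coherent K p_lam q \<longleftrightarrow> proportional q P"
proof -
  let ?I = "\<integral>x. P x \<partial>lborel"
  have coh: "coherent K p_lam q \<longleftrightarrow> (AE x in lborel. q x = (1 / ?I) * P x)"
    using c by (simp add: coherent_def diag)
  have q1: "(\<integral>x. q x \<partial>lborel) = 1"
    using q by (subst integral_eq_nn_integral) (auto simp: prob_density_def)
  show ?thesis
  proof
    assume "coherent K p_lam q"
    moreover have "0 < 1 / ?I" using P by simp
    ultimately show "proportional q P" unfolding coh proportional_def by blast
  next
    assume "proportional q P"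
    then obtain d where d: "AE x in lborel. q x = d * P x" by (auto simp: proportional_def)
    have Pint: "integrable lborel P" using P not_integrable_integral_eq by fastforce
    have "1 = (\<integral>x. d * P x \<partial>lborel)"
      unfolding q1[symmetric]
      by (rule integral_cong_AE) (use d q Pint in \<open>auto simp: prob_density_def\<close>)
    also have "\<dots> = d * ?I" by simp
    finally have "d = 1 / ?I" using P by (simp add: field_simps)
    then show "coherent K p_lam q" using d coh by simp
  qed
qed

lemma diagonal_point:
  "(\<lambda>i\<in>{1..K::nat}. if i = 1 then x else (\<lambda>i\<in>{2..K}. 0) i + x) = (\<lambda>i\<in>{1..K}. x :: real)"
  by (auto simp: restrict_def fun_eq_iff)

theorem mainTheorem9:
  fixes K :: nat
    and \<pi> :: "nat \<Rightarrow> real \<Rightarrow> real"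
    and q :: "real \<Rightarrow> real"
  assumes "1 \<le> K"
    and "\<And>i. i \<in> {1..K} \<Longrightarrow> prob_density lborel (\<pi> i)"
    and "0 < (\<integral>\<^sup>+x. ennreal (\<Prod>i=1..K. \<pi> i x) \<partial>lborel)"
    and "(\<integral>\<^sup>+x. ennreal (\<Prod>i=1..K. \<pi> i x) \<partial>lborel) < \<infinity>"
    and "prob_density lborel q"
  shows "(coherent K (constrained_prior K \<pi>) q \<longleftrightarrow> proportional q (\<lambda>x. \<Prod>i=1..K. \<pi> i x))
    \<and> (coherent K (constrained_prior K \<pi>) q \<longleftrightarrow> coherent K (unconstrained_prior K \<pi>) q)
    \<and> ((\<forall>i\<in>{1..K}. AE x in lborel. \<pi> i x = \<pi> 1 x) \<longrightarrow>
        (coherent K (constrained_prior K \<pi>) q \<longleftrightarrow> proportional q (\<lambda>x. \<pi> 1 x ^ K)))"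
proof -
  let ?P = "\<lambda>x. \<Prod>i=1..K. \<pi> i x"
  let ?Z = "\<integral>m. (\<Prod>i=1..K. \<pi> i (m i)) * indicator (ordered_cone K) m \<partial>lborel_vec K"
  have meas: "?P \<in> borel_measurable lborel"
    using assms(2) by (intro borel_measurable_prod) (auto simp: prob_density_def)
  have nonneg: "0 \<le> ?P x" for x
    using assms(2) by (intro prod_nonneg) (auto simp: prob_density_def)
  have P_pos: "0 < (\<integral>x. ?P x \<partial>lborel)"
    using assms(3,4) meas nonneg by (simp add: integral_eq_nn_integral enn2real_positive_iff)
  have Z_pos: "0 < ?Z" using cone_integral_pos[OF assms(2,3)] .
  have diag_c: "joint_density K (constrained_prior K \<pi>) x (\<lambda>i\<in>{2..K}. 0) = (1 / ?Z) * ?P x" for x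
  proof -
    have "(\<lambda>i\<in>{1..K}. x) \<in> ordered_cone K" by (auto simp: ordered_cone_def)
    then show ?thesis
      unfolding joint_density_def diagonal_point constrained_prior_def by simp
  qed
  have diag_u: "joint_density K (unconstrained_prior K \<pi>) x (\<lambda>i\<in>{2..K}. 0) = 1 * ?P x" for x
    unfolding joint_density_def diagonal_point unconstrained_prior_def by simp
  have con: "coherent K (constrained_prior K \<pi>) q \<longleftrightarrow> proportional q ?P"
    by (rule coherent_iff_proportional[OF diag_c _ assms(5) P_pos]) (use Z_pos in simp)
  have unc: "coherent K (unconstrained_prior K \<pi>) q \<longleftrightarrow> proportional q ?P"
    by (rule coherent_iff_proportional[OF diag_u _ assms(5) P_pos]) simp
  have "proportional q ?P \<longleftrightarrow> proportional q (\<lambda>x. \<pi> 1 x ^ K)"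
    if "\<forall>i\<in>{1..K}. AE x in lborel. \<pi> i x = \<pi> 1 x"
  proof -
    have "AE x in lborel. \<forall>i\<in>{1..K}. \<pi> i x = \<pi> 1 x"
      using that by (intro AE_finite_allI) auto
    then have eq: "AE x in lborel. ?P x = \<pi> 1 x ^ K"
    proof eventually_elim
      case (elim x)
      then have "?P x = (\<Prod>i=1..K. \<pi> 1 x)" by (intro prod.cong) blast+
      then show ?case by simp
    qed
    have "(AE x in lborel. q x = d * ?P x) \<longleftrightarrow> (AE x in lborel. q x = d * \<pi> 1 x ^ K)" for d
      by (rule eventually_subst, use eq in eventually_elim) simp
    then show ?thesis by (simp add: proportional_def)
  qed
  then show ?thesis using con unc by blast
qed

end
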